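(* Let $k$ be a field of characteristic $\neq 2$, let $A=(A,\cdot)$ be a Jordan algebra over $k$, $E$ a $k$-vector space (containing $A$ as a subspace) and $\cdot_E$ a Jordan algebra structure on $E$ containing $A$ as a Jordan subalgebra. Then there exist a Jordan extending structure $\Omega(A,V)=(\triangleleft,\triangleright,f,\cdot_V)$ of $A$ through a subspace $V$ of $E$ and an isomorphism of Jordan algebras $(E,\cdot_E)\cong A\,\natural\,V$ that stabilizes $A$, i.e. that sends each $a\in A$ to $(a,0)$.
   Context: $k$ is a field of characteristic $\neq 2$; all vector spaces and (bi)linear maps are over $k$. A Jordan algebra is a vector space $A$ with a commutative bilinear multiplication satisfying $(a^2\cdot b)\cdot a=a^2\cdot(b\cdot a)$ for all $a,b$ (no unit assumed). An extending datum of a Jordan algebra $A$ through a vector space $V$ is a system $\Omega(A,V)=(\triangleleft,\triangleright,f,\cdot_V)$ of four bilinear maps $\triangleleft:V\times A\to V$, $\triangleright:V\times A\to A$, $f:V\times V\to A$, $\cdot_V:V\times V\to V$. Denote by $A\,\natural\,V$ the vector space $A\times V$ with the bilinear multiplication $$(a,x)\circ(b,y):=\bigl(a\cdot b+x\triangleright b+y\triangleright a+f(x,y),\; x\triangleleft b+y\triangleleft a+x\cdot_V y\bigr).$$ The datum is called a Jordan extending structure of $A$ through $V$ if $(A\,\natural\,V,\circ)$ is a Jordan algebra; in that case $A\,\natural\,V$ is called the unified product of $A$ and $V$. $A$ is viewed as the subalgebra $A\times\{0\}$ of $A\,\natural\,V$ via $a\mapsto(a,0)$. *)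

theory Defs
  imports "HOL-Analysis.Product_Vector" "HOL-Library.FuncSet"
begin

text \<open>
  A vector space over the field \<open>'k\<close> is given by a carrier set that is a subspace of an ambient type
  carrying a scalar multiplication. Maps between such spaces are total functions on the ambient
  types, and all requirements on them are relativised to the carriers; their values outside the
  carriers are irrelevant.
\<close>

definition vector_space_on ::
  "('k::field \<Rightarrow> 'a::ab_group_add \<Rightarrow> 'a) \<Rightarrow> 'a set \<Rightarrow> bool" where
  "vector_space_on s U \<longleftrightarrow> vector_space s \<and> module.subspace s U"

definition linear_on ::
  "('k::field \<Rightarrow> 'a::ab_group_add \<Rightarrow> 'a) \<Rightarrow> ('k \<Rightarrow> 'b::ab_group_add \<Rightarrow> 'b) \<Rightarrow>
   'a set \<Rightarrow> 'b set \<Rightarrow> ('a \<Rightarrow> 'b) \<Rightarrow> bool" where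
  "linear_on s t U W h \<longleftrightarrow>
     h \<in> U \<rightarrow> W \<and>
     (\<forall>x\<in>U. \<forall>y\<in>U. h (x + y) = h x + h y) \<and>
     (\<forall>c. \<forall>x\<in>U. h (s c x) = t c (h x))"

definition bilinear_on ::
  "('k::field \<Rightarrow> 'a::ab_group_add \<Rightarrow> 'a) \<Rightarrow> ('k \<Rightarrow> 'b::ab_group_add \<Rightarrow> 'b) \<Rightarrow>
   ('k \<Rightarrow> 'c::ab_group_add \<Rightarrow> 'c) \<Rightarrow>
   'a set \<Rightarrow> 'b set \<Rightarrow> 'c set \<Rightarrow> ('a \<Rightarrow> 'b \<Rightarrow> 'c) \<Rightarrow> bool" where
  "bilinear_on s t u X Y Z h \<longleftrightarrow>
     (\<forall>x\<in>X. linear_on t u Y Z (\<lambda>y. h x y)) \<and>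
     (\<forall>y\<in>Y. linear_on s u X Z (\<lambda>x. h x y))"

definition jordan_algebra_on ::
  "('k::field \<Rightarrow> 'a::ab_group_add \<Rightarrow> 'a) \<Rightarrow> 'a set \<Rightarrow> ('a \<Rightarrow> 'a \<Rightarrow> 'a) \<Rightarrow> bool" where
  "jordan_algebra_on s A m \<longleftrightarrow>
     vector_space_on s A \<and>
     bilinear_on s s s A A A m \<and>
     (\<forall>a\<in>A. \<forall>b\<in>A. m a b = m b a) \<and>
     (\<forall>a\<in>A. \<forall>b\<in>A. m (m (m a a) b) a = m (m a a) (m b a))"

definition jordan_subalgebra_on ::
  "('k::field \<Rightarrow> 'a::ab_group_add \<Rightarrow> 'a) \<Rightarrow>
   'a set \<Rightarrow> ('a \<Rightarrow> 'a \<Rightarrow> 'a) \<Rightarrow> 'a set \<Rightarrow> ('a \<Rightarrow> 'a \<Rightarrow> 'a) \<Rightarrow> bool" where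
  "jordan_subalgebra_on s A mA E mE \<longleftrightarrow>
     jordan_algebra_on s A mA \<and> jordan_algebra_on s E mE \<and>
     A \<subseteq> E \<and> (\<forall>a\<in>A. \<forall>b\<in>A. mE a b = mA a b)"

definition jordan_algebra_iso_on ::
  "('k::field \<Rightarrow> 'a::ab_group_add \<Rightarrow> 'a) \<Rightarrow> 'a set \<Rightarrow> ('a \<Rightarrow> 'a \<Rightarrow> 'a) \<Rightarrow>
   ('k \<Rightarrow> 'b::ab_group_add \<Rightarrow> 'b) \<Rightarrow> 'b set \<Rightarrow> ('b \<Rightarrow> 'b \<Rightarrow> 'b) \<Rightarrow> ('a \<Rightarrow> 'b) \<Rightarrow> bool" where
  "jordan_algebra_iso_on s A m t B n h \<longleftrightarrow>
     linear_on s t A B h \<and> bij_betw h A B \<and>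
     (\<forall>x\<in>A. \<forall>y\<in>A. h (m x y) = n (h x) (h y))"

text \<open>
  In the following, \<open>ra\<close> is the map \<open>\<triangleleft> : V \<times> A \<rightarrow> V\<close> and \<open>la\<close> is the map \<open>\<triangleright> : V \<times> A \<rightarrow> A\<close>;
  both take the argument from \<open>V\<close> first.
\<close>

definition extending_datum ::
  "('k::field \<Rightarrow> 'a::ab_group_add \<Rightarrow> 'a) \<Rightarrow> 'a set \<Rightarrow> ('a \<Rightarrow> 'a \<Rightarrow> 'a) \<Rightarrow>
   ('k \<Rightarrow> 'v::ab_group_add \<Rightarrow> 'v) \<Rightarrow> 'v set \<Rightarrow>
   ('v \<Rightarrow> 'a \<Rightarrow> 'v) \<Rightarrow> ('v \<Rightarrow> 'a \<Rightarrow> 'a) \<Rightarrow> ('v \<Rightarrow> 'v \<Rightarrow> 'a) \<Rightarrow> ('v \<Rightarrow> 'v \<Rightarrow> 'v) \<Rightarrow> bool" where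
  "extending_datum s A mA t V ra la f mV \<longleftrightarrow>
     jordan_algebra_on s A mA \<and> vector_space_on t V \<and>
     bilinear_on t s t V A V ra \<and>
     bilinear_on t s s V A A la \<and>
     bilinear_on t t s V V A f \<and>
     bilinear_on t t t V V V mV"

definition unified_mult ::
  "('a::ab_group_add \<Rightarrow> 'a \<Rightarrow> 'a) \<Rightarrow> ('v::ab_group_add \<Rightarrow> 'a \<Rightarrow> 'v) \<Rightarrow> ('v \<Rightarrow> 'a \<Rightarrow> 'a) \<Rightarrow>
   ('v \<Rightarrow> 'v \<Rightarrow> 'a) \<Rightarrow> ('v \<Rightarrow> 'v \<Rightarrow> 'v) \<Rightarrow> 'a \<times> 'v \<Rightarrow> 'a \<times> 'v \<Rightarrow> 'a \<times> 'v" where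
  "unified_mult mA ra la f mV = (\<lambda>(a, x) (b, y).
     (mA a b + la x b + la y a + f x y, ra x b + ra y a + mV x y))"

definition jordan_extending_structure ::
  "('k::field \<Rightarrow> 'a::ab_group_add \<Rightarrow> 'a) \<Rightarrow> 'a set \<Rightarrow> ('a \<Rightarrow> 'a \<Rightarrow> 'a) \<Rightarrow>
   ('k \<Rightarrow> 'v::ab_group_add \<Rightarrow> 'v) \<Rightarrow> 'v set \<Rightarrow>
   ('v \<Rightarrow> 'a \<Rightarrow> 'v) \<Rightarrow> ('v \<Rightarrow> 'a \<Rightarrow> 'a) \<Rightarrow> ('v \<Rightarrow> 'v \<Rightarrow> 'a) \<Rightarrow> ('v \<Rightarrow> 'v \<Rightarrow> 'v) \<Rightarrow> bool" where
  "jordan_extending_structure s A mA t V ra la f mV \<longleftrightarrow>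
     extending_datum s A mA t V ra la f mV \<and>
     jordan_algebra_on (module_prod.scale s t) (A \<times> V) (unified_mult mA ra la f mV)"

end

theory Submission
  imports Defs
begin

text \<open>
  Choose a linear projection \<open>p\<close> of \<open>E\<close> onto \<open>A\<close> and put \<open>V = ker p\<close>. The map
  \<open>x \<mapsto> (p x, x - p x)\<close> is a linear bijection \<open>E \<rightarrow> A \<times> V\<close>, and the datum is obtained by splitting the
  products \<open>V \<cdot> A\<close> and \<open>V \<cdot> V\<close> of \<open>E\<close> into their components along \<open>A\<close> and \<open>V\<close>; it is exactly
  the one for which this bijection is multiplicative. The Jordan identities of \<open>A \<natural> V\<close> are
  transported from \<open>E\<close>.
\<close>

lemma linear_onD:
  assumes "linear_on s t U W h"
  shows "\<And>x. x \<in> U \<Longrightarrow> h x \<in> W"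
    and "\<And>x y. x \<in> U \<Longrightarrow> y \<in> U \<Longrightarrow> h (x + y) = h x + h y"
    and "\<And>c x. x \<in> U \<Longrightarrow> h (s c x) = t c (h x)"
  using assms by (auto simp: linear_on_def)

lemma bilinear_onD:
  assumes "bilinear_on s t u X Y Z m"
  shows "\<And>x y. x \<in> X \<Longrightarrow> y \<in> Y \<Longrightarrow> m x y \<in> Z"
    and "\<And>x x' y. x \<in> X \<Longrightarrow> x' \<in> X \<Longrightarrow> y \<in> Y \<Longrightarrow> m (x + x') y = m x y + m x' y"
    and "\<And>x y y'. x \<in> X \<Longrightarrow> y \<in> Y \<Longrightarrow> y' \<in> Y \<Longrightarrow> m x (y + y') = m x y + m x y'"
    and "\<And>c x y. x \<in> X \<Longrightarrow> y \<in> Y \<Longrightarrow> m (s c x) y = u c (m x y)"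
    and "\<And>c x y. x \<in> X \<Longrightarrow> y \<in> Y \<Longrightarrow> m x (t c y) = u c (m x y)"
  using assms by (auto simp: bilinear_on_def linear_on_def)

text \<open>Tailored to the extending datum: each of its four maps is the product of
  \<open>E\<close>, restricted to smaller arguments and followed by a linear projection.\<close>

lemma bilinear_on_comp_linear_on:
  assumes "bilinear_on s t u X Y Z m" and "linear_on u v Z W h"
    and "X' \<subseteq> X" and "Y' \<subseteq> Y"
  shows "bilinear_on s t v X' Y' W (\<lambda>x y. h (m x y))"
  using assms by (auto simp: bilinear_on_def linear_on_def Pi_iff subset_iff)

text \<open>Since \<open>h\<close> is onto \<open>B\<close>, each law of \<open>n\<close> is the
  image under \<open>h\<close> of the same law of \<open>m\<close>. The assumption on
  \<open>B\<close> supplies the vector space laws of \<open>t\<close> on the whole ambient type,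
  which \<open>h\<close> cannot provide.\<close>

lemma jordan_algebra_on_iso_image:
  assumes J: "jordan_algebra_on s A m"
    and iso: "jordan_algebra_iso_on s A m t B n h"
    and B: "vector_space_on t B"
  shows "jordan_algebra_on t B n"
proof -
  have lin: "linear_on s t A B h" and img: "B = h ` A"
    and mult: "\<And>x y. x \<in> A \<Longrightarrow> y \<in> A \<Longrightarrow> n (h x) (h y) = h (m x y)"
    using iso by (auto simp: jordan_algebra_iso_on_def bij_betw_def)
  have bil: "bilinear_on s s s A A A m"
    and comm: "\<And>a b. a \<in> A \<Longrightarrow> b \<in> A \<Longrightarrow> m a b = m b a"
    and jord: "\<And>a b. a \<in> A \<Longrightarrow> b \<in> A \<Longrightarrow> m (m (m a a) b) a = m (m a a) (m b a)"
    and A: "vector_space s" "module.subspace s A"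
    using J by (auto simp: jordan_algebra_on_def vector_space_on_def)
  interpret vector_space s by fact
  note closed = subspace_add[OF A(2)] subspace_scale[OF A(2)] bilinear_onD(1)[OF bil]
  \<comment> \<open>Oriented so that sums, scalar multiples and products of values of
    \<open>h\<close> collapse to a single value of \<open>h\<close>.\<close>
  note h_simps = linear_onD(2,3)[OF lin, symmetric] mult
  have "bilinear_on t t t B B B n"
    unfolding bilinear_on_def linear_on_def img
    by (auto simp: h_simps closed bilinear_onD[OF bil])
  moreover have "\<forall>a\<in>B. \<forall>b\<in>B. n a b = n b a"
    unfolding img by (auto simp: mult comm)
  moreover have "\<forall>a\<in>B. \<forall>b\<in>B. n (n (n a a) b) a = n (n a a) (n b a)"
    unfolding img by (simp add: mult closed jord)
  ultimately show ?thesis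
    using B by (simp add: jordan_algebra_on_def)
qed

text \<open>The identity is injective on the subspace \<open>A\<close>, so it has a linear left
  inverse there with range in \<open>A\<close>; this is the projection.\<close>

lemma (in vector_space) exists_linear_projection:
  assumes "subspace A"
  obtains p where "Vector_Spaces.linear scale scale p" "range p \<subseteq> A" "\<And>a. a \<in> A \<Longrightarrow> p a = a"
proof -
  interpret vector_space_pair scale scale ..
  show ?thesis
    using linear_exists_left_inverse_on[OF linear_ident assms] that by auto
qed

lemma vector_space_on_Times:
  assumes "vector_space_on s U" and "vector_space_on t W"
  shows "vector_space_on (module_prod.scale s t) (U \<times> W)"
proof -
  interpret s: vector_space s using assms by (simp add: vector_space_on_def)
  interpret t: vector_space t using assms by (simp add: vector_space_on_def)
  interpret vector_space_prod s t ..
  have "p.subspace (U \<times> W)"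
    using assms by (simp add: vector_space_on_def subspace_Times)
  then show ?thesis
    by (simp add: vector_space_on_def p.vector_space_axioms)
qed

lemma unified_product_of_projection:
  assumes E: "jordan_algebra_on s UNIV mE"
    and A: "jordan_algebra_on s A mA" and mA: "\<And>a b. a \<in> A \<Longrightarrow> b \<in> A \<Longrightarrow> mE a b = mA a b"
    and p: "Vector_Spaces.linear s s p" "range p \<subseteq> A" "\<And>a. a \<in> A \<Longrightarrow> p a = a"
  defines "V \<equiv> {x. p x = 0}" and "q \<equiv> \<lambda>x. x - p x"
  defines "ra \<equiv> \<lambda>x a. q (mE x a)" and "la \<equiv> \<lambda>x a. p (mE x a)"
    and "f \<equiv> \<lambda>x y. p (mE x y)" and "mV \<equiv> \<lambda>x y. q (mE x y)"
  shows "module.subspace s V"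
    and "jordan_extending_structure s A mA s V ra la f mV"
    and "jordan_algebra_iso_on s UNIV mE
      (module_prod.scale s s) (A \<times> V) (unified_mult mA ra la f mV) (\<lambda>x. (p x, q x))"
proof -
  have bil: "bilinear_on s s s UNIV UNIV UNIV mE"
    and comm: "\<And>a b. mE a b = mE b a"
    using E by (auto simp: jordan_algebra_on_def)
  interpret p: Vector_Spaces.linear s s p by fact
  interpret prod: vector_space_prod s s ..
  have mA_in: "\<And>a b. a \<in> A \<Longrightarrow> b \<in> A \<Longrightarrow> mA a b \<in> A"
    using A bilinear_onD(1) by (auto simp: jordan_algebra_on_def)
  have p_in: "p x \<in> A" for x
    using p(2) by auto
  \<comment> \<open>\<open>p\<close> is idempotent, because it fixes its own values.\<close>
  have q_in: "q x \<in> V" for x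
    by (simp add: V_def q_def p.diff p(3)[OF p_in])
  show V: "module.subspace s V"
    unfolding V_def by (rule p.subspace_kernel)
  have lin_p: "linear_on s s UNIV A p"
    by (simp add: linear_on_def p_in p.add p.scale)
  have lin_q: "linear_on s s UNIV V q"
    using q_in by (simp add: linear_on_def q_def p.add p.scale p.vs1.scale_right_diff_distrib)
  have vV: "vector_space_on s V"
    using V by (simp add: vector_space_on_def p.vs1.vector_space_axioms)
  have datum: "extending_datum s A mA s V ra la f mV"
    unfolding extending_datum_def ra_def la_def f_def mV_def
    using A vV by (simp add: bilinear_on_comp_linear_on[OF bil lin_p]
        bilinear_on_comp_linear_on[OF bil lin_q])
  have "linear_on s (module_prod.scale s s) UNIV (A \<times> V) (\<lambda>x. (p x, q x))"
    using lin_p lin_q by (auto simp: linear_on_def prod.scale_def)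
  \<comment> \<open>The inverse adds the components: \<open>p (a + x) = a\<close> for
    \<open>a\<close> in \<open>A\<close> and \<open>x\<close> in the kernel
    \<open>V\<close>.\<close>
  moreover have "bij_betw (\<lambda>x. (p x, q x)) UNIV (A \<times> V)"
    by (rule bij_betw_byWitness[where f' = "\<lambda>(a, x). a + x"])
      (auto simp: p_in q_in, auto simp: q_def V_def p.add p(3))
  moreover have "(p (mE x y), q (mE x y)) =
      unified_mult mA ra la f mV (p x, q x) (p y, q y)" for x y
  proof -
    \<comment> \<open>Commutativity turns \<open>mE (p x) (q y)\<close> around, since
      \<open>ra\<close> and \<open>la\<close> take the argument from \<open>V\<close> first.\<close>
    have "mE (p x + q x) (p y + q y) =
        mA (p x) (p y) + mE (q x) (p y) + mE (q y) (p x) + mE (q x) (q y)"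
      by (simp add: bilinear_onD[OF bil] mA p_in comm[of "p x" "q y"] algebra_simps)
    then have xy: "mE x y = mA (p x) (p y) + mE (q x) (p y) + mE (q y) (p x) + mE (q x) (q y)"
      by (simp add: q_def)
    \<comment> \<open>Products within \<open>A\<close> stay in \<open>A\<close>, matching the lack
      of such a term in the second component of \<open>unified_mult\<close>.\<close>
    have "q (mA (p x) (p y)) = 0"
      by (simp add: q_def p(3) mA_in p_in)
    then show ?thesis
      by (simp add: xy unified_mult_def ra_def la_def f_def mV_def p.add linear_onD(2)[OF lin_q]
          p(3) mA_in p_in)
  qed
  ultimately show iso: "jordan_algebra_iso_on s UNIV mE
      (module_prod.scale s s) (A \<times> V) (unified_mult mA ra la f mV) (\<lambda>x. (p x, q x))"
    by (simp add: jordan_algebra_iso_on_def)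
  have "vector_space_on s A"
    using A by (simp add: jordan_algebra_on_def)
  \<comment> \<open>The isomorphism \<open>iso\<close> was proved without knowing that its target is
    a Jordan algebra, so it can be used here to show this.\<close>
  then show "jordan_extending_structure s A mA s V ra la f mV"
    using datum jordan_algebra_on_iso_image[OF E iso vector_space_on_Times[OF _ vV]]
    by (simp add: jordan_extending_structure_def)
qed

theorem theorem2p7:
  fixes s :: "'k::field \<Rightarrow> 'e::ab_group_add \<Rightarrow> 'e"
    and A :: "'e set"
    and mA mE :: "'e \<Rightarrow> 'e \<Rightarrow> 'e"
  assumes "CHAR('k) \<noteq> 2"
    and "vector_space s"
    and "jordan_algebra_on s A mA"
    and "jordan_algebra_on s UNIV mE"
    and "jordan_subalgebra_on s A mA UNIV mE"
  shows "\<exists>V ra la f mV h.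
    module.subspace s V \<and>
    jordan_extending_structure s A mA s V ra la f mV \<and>
    jordan_algebra_iso_on s UNIV mE
      (module_prod.scale s s) (A \<times> V) (unified_mult mA ra la f mV) h \<and>
    (\<forall>a\<in>A. h a = (a, 0))"
proof -
  interpret vector_space s by fact
  have "subspace A"
    using assms(3) by (simp add: jordan_algebra_on_def vector_space_on_def)
  then obtain p where p: "Vector_Spaces.linear s s p" "range p \<subseteq> A" "\<And>a. a \<in> A \<Longrightarrow> p a = a"
    by (rule exists_linear_projection) blast
  have mA: "\<And>a b. a \<in> A \<Longrightarrow> b \<in> A \<Longrightarrow> mE a b = mA a b"
    using assms(5) by (simp add: jordan_subalgebra_on_def)
  \<comment> \<open>The pair is the isomorphism of the preceding lemma with \<open>q\<close>
    unfolded.\<close>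
  have "\<forall>a\<in>A. (p a, a - p a) = (a, 0)"
    using p(3) by simp
  with unified_product_of_projection[OF assms(4,3) mA p] show ?thesis
    by blast
qed

end
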